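(* Let $\rho\in[0,1)$, let $S\in\mathbb{R}^{N\times N}$ be symmetric positive definite, let $\{\sigma_k\}_{k\ge0}$ be a positive sequence with $\sigma_k\ge\sigma_{\min}>0$ for all $k\ge0$, and let $\{\tau_k\}_{k\ge0}$ be a positive sequence satisfying $$\tau_k\ge\tau_{\min}>0,\qquad \tau_{k+1}\le(1+\nu_k)\tau_k,\qquad \nu_k\ge0,\qquad \sum_{k=0}^\infty\nu_k<+\infty .$$ Suppose that $\ell$ admits a saddle point (i.e. $(\partial\ell)^{-1}(0,0)\ne\emptyset$), and let $(x^*,y^* )$ be an arbitrary saddle point of $\ell$. Let $\{x^k\}$ and $\{y^k:=(\lambda^k,\mu^k)\}$ be (infinite) sequences generated by the rip$^2$ALM (defined in the context) with these parameters, and define $$\widehat{x}^k:=\frac{\sum_{i=0}^{k-1}\sigma_ix^{i+1}}{\sum_{i=0}^{k-1}\sigma_i}.$$ Then, for all $k\ge1$, $$\mathtt{feas}(\widehat{x}^k):=\left\|\begin{pmatrix}A\widehat{x}^k-b\\ \max\{0,g(\widehat{x}^k)\}\end{pmatrix}\right\|\le\Xi_k:=\frac{2B_y}{\sum_{i=0}^{k-1}\sigma_i}$$ and $$-\|y^*\|\,\Xi_k-\frac{\sigma_k}{2}\,\Xi_k^2\le f(\widehat{x}^k)-f(x^* )\le\frac{C_0+\rho\,C_{xy}}{\sum_{i=0}^{k-1}\sigma_i},$$ where the finite constants $B_y$, $C_0$, $C_{xy}$ are as defined in the context.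
   Context: Problem. $f:\mathbb{R}^N\to\mathbb{R}\cup\{+\infty\}$ is a proper closed (lower semicontinuous) convex function, $A\in\mathbb{R}^{m_1\times N}$, $b\in\mathbb{R}^{m_1}$, and $g=(g_1,\dots,g_{m_2})$ with each $g_i:\mathbb{R}^N\to\mathbb{R}$ continuously differentiable and convex; $M:=m_1+m_2$. The problem is $\min_x f(x)$ subject to $Ax=b$, $g(x)\le0$ (componentwise). Lagrangian. For $y=(\lambda,\mu)\in\mathbb{R}^{m_1}\times\mathbb{R}^{m_2}$, $$\ell(x,y)=\begin{cases}f(x)+\langle\lambda,Ax-b\rangle+\langle\mu,g(x)\rangle,&\mu\ge0,\\-\infty,&\text{otherwise.}\end{cases}$$ Subdifferential of $\ell$: $(p,u)\in\partial\ell(x,y)$ iff $\ell(x',y)\ge\ell(x,y)+\langle p,x'-x\rangle$ for all $x'\in\mathbb{R}^N$ and $\ell(x,y')\le\ell(x,y)-\langle u,y'-y\rangle$ for all $y'\in\mathbb{R}^M$. $(\partial\ell)^{-1}(p,u):=\{(x,y):(p,u)\in\partial\ell(x,y)\}$; a saddle point of $\ell$ is an element of $(\partial\ell)^{-1}(0,0)$. Norms are Euclidean; $\|x\|_S:=\sqrt{\langle x,Sx\rangle}$; $\lambda_{\max}(S)$ is the largest eigenvalue of $S$; $\max$ and $\min$ of vectors are componentwise. Augmented Lagrangian: for $\sigma>0$ and $(x,\lambda,\mu)\in\mathbb{R}^N\times\mathbb{R}^{m_1}\times\mathbb{R}^{m_2}_+$, $$\mathcal{L}_\sigma(x,\lambda,\mu)=f(x)+\langle\lambda,Ax-b\rangle+\tfrac{\sigma}{2}\|Ax-b\|^2+\tfrac{1}{2\sigma}\|\max\{0,\mu+\sigma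 g(x)\}\|^2-\tfrac{1}{2\sigma}\|\mu\|^2 ,$$ with $\partial_x\mathcal{L}_\sigma$ its convex subdifferential in $x$. rip$^2$ALM. Inputs: $\rho\in[0,1)$, positive $\{\sigma_k\}$, $\{\tau_k\}$ bounded away from $0$, $S$ symmetric positive definite; arbitrary $w^0,x^0\in\mathbb{R}^N$, $\lambda^0\in\mathbb{R}^{m_1}$, $\mu^0\in\mathbb{R}^{m_2}_+$. For $k=0,1,2,\dots$: Step 1: find any $x^{k+1}$ and $\Delta^{k+1}$ in $\mathbb{R}^N$ (by approximately minimizing $\mathcal{L}_{\sigma_k}(x,\lambda^k,\mu^k)+\frac{\tau_k}{2\sigma_k}\|x-x^k\|_S^2$ over $x$) such that $$\Delta^{k+1}\in\partial_x\mathcal{L}_{\sigma_k}(x^{k+1},\lambda^k,\mu^k)+\tau_k\sigma_k^{-1}S(x^{k+1}-x^k)$$ and $$2|\langle w^k-x^{k+1},\sigma_k\Delta^{k+1}\rangle|+\|\sigma_k\Delta^{k+1}\|^2\le\rho\Big(\|\sigma_k(Ax^{k+1}-b)\|^2+\|\min\{\mu^k,-\sigma_kg(x^{k+1})\}\|^2+\tau_k\|x^{k+1}-x^k\|_S^2\Big).$$ Step 2: set $\lambda^{k+1}=\lambda^k+\sigma_k(Ax^{k+1}-b)$, $\mu^{k+1}=\max\{0,\mu^k+\sigma_kg(x^{k+1})\}$, $w^{k+1}=w^k-\sigma_k\Delta^{k+1}$. Constants (all finite under the stated assumptions). $B_x$ and $B_y$ are upper bounds on the sequences $\{x^k\}$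 and $\{y^k\}$: $\|x^k\|\le B_x$ and $\|y^k\|\le B_y$ for all $k\ge0$. $\tau_{\max}:=\tau_0\prod_{k=0}^\infty(1+\nu_k)$. $$C_0:=\tfrac{\tau_0}{2}\|x^*-x^0\|_S^2+\tfrac12\|y^0\|^2+\tfrac12\|x^*-w^0\|^2+\lambda_{\max}(S)\big(\|x^*\|^2+B_x^2\big)\tau_{\max}\sum_{i=0}^\infty\nu_i,$$ $$C_{xy}:=\tfrac12\sum_{k=0}^\infty\big(\|y^{k+1}-y^k\|^2+\tau_k\|x^{k+1}-x^k\|_S^2\big).$$ *)

theory Defs
  imports "HOL-Analysis.Analysis"
begin

section \<open>Extended-real-valued convex functions\<close>

definition proper_fun :: "('a \<Rightarrow> ereal) \<Rightarrow> bool" where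
  "proper_fun f \<longleftrightarrow> (\<forall>x. f x \<noteq> -\<infinity>) \<and> (\<exists>x. f x \<noteq> \<infinity>)"

definition lower_semicontinuous :: "('a::topological_space \<Rightarrow> ereal) \<Rightarrow> bool" where
  "lower_semicontinuous f \<longleftrightarrow> (\<forall>x. f x \<le> Liminf (at x) f)"

text \<open>Only meant for functions that never take the value \<open>-\<infinity>\<close>, so that no
  sum \<open>\<infinity> + (-\<infinity>)\<close> occurs; \<open>t\<close> is strictly between 0 and 1, so that no product
  \<open>0 * \<infinity>\<close> occurs either.\<close>

definition ereal_convex :: "('a::real_vector \<Rightarrow> ereal) \<Rightarrow> bool" where
  "ereal_convex f \<longleftrightarrow> (\<forall>x z. \<forall>t::real. 0 < t \<and> t < 1 \<longrightarrow>
     f ((1 - t) *\<^sub>R x + t *\<^sub>R z) \<le> ereal (1 - t) * f x + ereal t * f z)"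

definition convex_subdifferential :: "('a::real_inner \<Rightarrow> ereal) \<Rightarrow> 'a \<Rightarrow> 'a set" where
  "convex_subdifferential h x = {v. \<forall>z. h x + ereal (v \<bullet> (z - x)) \<le> h z}"

definition continuously_differentiable :: "('a::real_inner \<Rightarrow> real) \<Rightarrow> bool" where
  "continuously_differentiable h \<longleftrightarrow>
     (\<exists>G::'a \<Rightarrow> 'a. continuous_on UNIV G \<and>
        (\<forall>x. (h has_derivative (\<lambda>v. G x \<bullet> v)) (at x)))"


section \<open>Vectors and matrices\<close>

text \<open>The library function \<^const>\<open>max\<close> is not componentwise on \<open>real ^ 'n\<close>, whose
  order is only partial; the order \<open>\<le>\<close> itself is componentwise.\<close>

definition vec_max :: "real ^ 'n \<Rightarrow> real ^ 'n \<Rightarrow> real ^ 'n" where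
  "vec_max u v = (\<chi> i. max (u $ i) (v $ i))"

definition vec_min :: "real ^ 'n \<Rightarrow> real ^ 'n \<Rightarrow> real ^ 'n" where
  "vec_min u v = (\<chi> i. min (u $ i) (v $ i))"

definition symmetric_pos_def :: "real ^ 'n ^ 'n \<Rightarrow> bool" where
  "symmetric_pos_def S \<longleftrightarrow> transpose S = S \<and> (\<forall>x. x \<noteq> 0 \<longrightarrow> 0 < x \<bullet> (S *v x))"

definition norm_wrt :: "real ^ 'n ^ 'n \<Rightarrow> real ^ 'n \<Rightarrow> real" where
  "norm_wrt S x = sqrt (x \<bullet> (S *v x))"

definition lambda_max :: "real ^ 'n ^ 'n \<Rightarrow> real" where
  "lambda_max S = Max {c. \<exists>v. v \<noteq> 0 \<and> S *v v = c *\<^sub>R v}"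


section \<open>The Lagrangian and its subdifferential\<close>

definition lagrangian ::
  "(real ^ 'n \<Rightarrow> ereal) \<Rightarrow> real ^ 'n ^ 'm1 \<Rightarrow> real ^ 'm1 \<Rightarrow> (real ^ 'n \<Rightarrow> real ^ 'm2)
    \<Rightarrow> real ^ 'n \<Rightarrow> (real ^ 'm1) \<times> (real ^ 'm2) \<Rightarrow> ereal" where
  "lagrangian f A b g x y =
     (if 0 \<le> snd y then f x + ereal (fst y \<bullet> (A *v x - b) + snd y \<bullet> g x) else -\<infinity>)"

definition saddle_subdifferential ::
  "('a::real_inner \<Rightarrow> 'b::real_inner \<Rightarrow> ereal) \<Rightarrow> 'a \<Rightarrow> 'b \<Rightarrow> ('a \<times> 'b) set" where
  "saddle_subdifferential l x y =
     {(p, u). (\<forall>x'. l x' y \<ge> l x y + ereal (p \<bullet> (x' - x))) \<and>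
              (\<forall>y'. l x y' \<le> l x y - ereal (u \<bullet> (y' - y)))}"

definition saddle_subdifferential_inv ::
  "('a::real_inner \<Rightarrow> 'b::real_inner \<Rightarrow> ereal) \<Rightarrow> 'a \<Rightarrow> 'b \<Rightarrow> ('a \<times> 'b) set" where
  "saddle_subdifferential_inv l p u = {(x, y). (p, u) \<in> saddle_subdifferential l x y}"

definition saddle_point ::
  "('a::real_inner \<Rightarrow> 'b::real_inner \<Rightarrow> ereal) \<Rightarrow> 'a \<Rightarrow> 'b \<Rightarrow> bool" where
  "saddle_point l x y \<longleftrightarrow> (x, y) \<in> saddle_subdifferential_inv l 0 0"

definition aug_lagrangian ::
  "(real ^ 'n \<Rightarrow> ereal) \<Rightarrow> real ^ 'n ^ 'm1 \<Rightarrow> real ^ 'm1 \<Rightarrow> (real ^ 'n \<Rightarrow> real ^ 'm2)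
    \<Rightarrow> real \<Rightarrow> real ^ 'n \<Rightarrow> real ^ 'm1 \<Rightarrow> real ^ 'm2 \<Rightarrow> ereal" where
  "aug_lagrangian f A b g \<sigma> x lam mu =
     f x + ereal (lam \<bullet> (A *v x - b) + \<sigma> / 2 * (norm (A *v x - b))\<^sup>2
       + 1 / (2 * \<sigma>) * (norm (vec_max 0 (mu + \<sigma> *\<^sub>R g x)))\<^sup>2
       - 1 / (2 * \<sigma>) * (norm mu)\<^sup>2)"


section \<open>The algorithm rip$^2$ALM\<close>

text \<open>The sequences \<open>x\<close>, \<open>\<Delta>\<close>, \<open>w\<close>, \<open>lam\<close>, \<open>mu\<close> form an infinite run of the algorithm.
  The error vectors are \<open>\<Delta> 1, \<Delta> 2, \<dots>\<close>; the value \<open>\<Delta> 0\<close> plays no role.\<close>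

definition rip2ALM ::
  "(real ^ 'n \<Rightarrow> ereal) \<Rightarrow> real ^ 'n ^ 'm1 \<Rightarrow> real ^ 'm1 \<Rightarrow> (real ^ 'n \<Rightarrow> real ^ 'm2)
    \<Rightarrow> real \<Rightarrow> (nat \<Rightarrow> real) \<Rightarrow> (nat \<Rightarrow> real) \<Rightarrow> real ^ 'n ^ 'n
    \<Rightarrow> (nat \<Rightarrow> real ^ 'n) \<Rightarrow> (nat \<Rightarrow> real ^ 'n) \<Rightarrow> (nat \<Rightarrow> real ^ 'n)
    \<Rightarrow> (nat \<Rightarrow> real ^ 'm1) \<Rightarrow> (nat \<Rightarrow> real ^ 'm2) \<Rightarrow> bool" where
  "rip2ALM f A b g \<rho> \<sigma> \<tau> S x \<Delta> w lam mu \<longleftrightarrow>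
     0 \<le> mu 0 \<and>
     (\<forall>k.
        \<Delta> (Suc k) \<in> (\<lambda>v. v + (\<tau> k * inverse (\<sigma> k)) *\<^sub>R (S *v (x (Suc k) - x k))) `
          convex_subdifferential (\<lambda>z. aug_lagrangian f A b g (\<sigma> k) z (lam k) (mu k)) (x (Suc k)) \<and>
        2 * \<bar>(w k - x (Suc k)) \<bullet> (\<sigma> k *\<^sub>R \<Delta> (Suc k))\<bar> + (norm (\<sigma> k *\<^sub>R \<Delta> (Suc k)))\<^sup>2
          \<le> \<rho> * ((norm (\<sigma> k *\<^sub>R (A *v x (Suc k) - b)))\<^sup>2
                 + (norm (vec_min (mu k) (- (\<sigma> k *\<^sub>R g (x (Suc k))))))\<^sup>2
                 + \<tau> k * (norm_wrt S (x (Suc k) - x k))\<^sup>2) \<and>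
        lam (Suc k) = lam k + \<sigma> k *\<^sub>R (A *v x (Suc k) - b) \<and>
        mu (Suc k) = vec_max 0 (mu k + \<sigma> k *\<^sub>R g (x (Suc k))) \<and>
        w (Suc k) = w k - \<sigma> k *\<^sub>R \<Delta> (Suc k))"

definition ergodic_iterate :: "(nat \<Rightarrow> real) \<Rightarrow> (nat \<Rightarrow> 'a::real_vector) \<Rightarrow> nat \<Rightarrow> 'a" where
  "ergodic_iterate \<sigma> x k = (\<Sum>i<k. \<sigma> i *\<^sub>R x (Suc i)) /\<^sub>R (\<Sum>i<k. \<sigma> i)"

definition feas ::
  "real ^ 'n ^ 'm1 \<Rightarrow> real ^ 'm1 \<Rightarrow> (real ^ 'n \<Rightarrow> real ^ 'm2) \<Rightarrow> real ^ 'n \<Rightarrow> real" where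
  "feas A b g x = norm (A *v x - b, vec_max 0 (g x))"


section \<open>The constants in the rate estimate\<close>

definition tau_max :: "(nat \<Rightarrow> real) \<Rightarrow> (nat \<Rightarrow> real) \<Rightarrow> real" where
  "tau_max \<tau> \<nu> = \<tau> 0 * (\<Prod>k. 1 + \<nu> k)"

definition const_C0 ::
  "real ^ 'n ^ 'n \<Rightarrow> (nat \<Rightarrow> real) \<Rightarrow> (nat \<Rightarrow> real) \<Rightarrow> real \<Rightarrow> real ^ 'n \<Rightarrow> real ^ 'n
    \<Rightarrow> 'y::real_normed_vector \<Rightarrow> real ^ 'n \<Rightarrow> real" where
  "const_C0 S \<tau> \<nu> B\<^sub>x xs x0 y0 w0 =
     \<tau> 0 / 2 * (norm_wrt S (xs - x0))\<^sup>2 + 1 / 2 * (norm y0)\<^sup>2 + 1 / 2 * (norm (xs - w0))\<^sup>2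
     + lambda_max S * ((norm xs)\<^sup>2 + B\<^sub>x\<^sup>2) * tau_max \<tau> \<nu> * (\<Sum>i. \<nu> i)"

definition Cxy_term ::
  "real ^ 'n ^ 'n \<Rightarrow> (nat \<Rightarrow> real) \<Rightarrow> (nat \<Rightarrow> real ^ 'n) \<Rightarrow> (nat \<Rightarrow> 'y::real_normed_vector)
    \<Rightarrow> nat \<Rightarrow> real" where
  "Cxy_term S \<tau> x y k =
     (norm (y (Suc k) - y k))\<^sup>2 + \<tau> k * (norm_wrt S (x (Suc k) - x k))\<^sup>2"

definition const_Cxy ::
  "real ^ 'n ^ 'n \<Rightarrow> (nat \<Rightarrow> real) \<Rightarrow> (nat \<Rightarrow> real ^ 'n) \<Rightarrow> (nat \<Rightarrow> 'y::real_normed_vector)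
    \<Rightarrow> real" where
  "const_Cxy S \<tau> x y = 1 / 2 * (\<Sum>k. Cxy_term S \<tau> x y k)"

definition Xi :: "real \<Rightarrow> (nat \<Rightarrow> real) \<Rightarrow> nat \<Rightarrow> real" where
  "Xi B\<^sub>y \<sigma> k = 2 * B\<^sub>y / (\<Sum>i<k. \<sigma> i)"

end

theory Submission
  imports Defs
begin

text \<open>
  For any multiplier \<open>\<eta>\<close> with nonnegative inequality part, the subgradient inequality at
  \<open>x\<^bsup>k+1\<^esup>\<close> and the multiplier update bound
  \<open>2 \<sigma>\<^sub>k (\<ell>(x\<^bsup>k+1\<^esup>, \<eta>) - f(x\<^sup>*))\<close> by the decrease of
  \<open>\<parallel>y\<^sup>k - \<eta>\<parallel>\<^sup>2 + \<tau>\<^sub>k \<parallel>x\<^sup>k - x\<^sup>*\<parallel>\<^sub>S\<^sup>2 + \<parallel>w\<^sup>k - x\<^sup>*\<parallel>\<^sup>2\<close>, up to a summable error caused by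
  the growth of \<open>\<tau>\<close>; the relative error criterion is exactly what absorbs the inexactness
  \<open>\<Delta>\<^bsup>k+1\<^esup>\<close> into the telescoping term in \<open>w\<close>. With \<open>\<eta> = y\<^sup>*\<close> the left-hand side is nonnegative, which
  yields boundedness and the summability behind \<open>C\<^sub>x\<^sub>y\<close>; with \<open>\<eta> = 0\<close>, summation and Jensen's inequality
  give the upper bound on the objective. Feasibility of the ergodic iterate follows by telescoping
  the multiplier updates, and the lower bound is the saddle point inequality at that iterate.
\<close>

section \<open>Vectors and symmetric matrices\<close>

lemma vec_max_nth [simp]: "vec_max u v $ i = max (u $ i) (v $ i)"
  by (simp add: vec_max_def)

lemma vec_min_nth [simp]: "vec_min u v $ i = min (u $ i) (v $ i)"
  by (simp add: vec_min_def)

lemma vec_max_0_nonneg: "0 \<le> vec_max 0 (u :: real ^ 'n)"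
  by (simp add: less_eq_vec_def)

lemma inner_vec_mono:
  fixes u v w :: "real ^ 'n"
  assumes "0 \<le> u" "v \<le> w"
  shows "u \<bullet> v \<le> u \<bullet> w"
  using assms by (auto simp: inner_vec_def less_eq_vec_def intro!: sum_mono mult_left_mono)

lemma norm_le_componentwise_vec:
  fixes u v :: "real ^ 'n"
  assumes "\<And>i. \<bar>u $ i\<bar> \<le> \<bar>v $ i\<bar>"
  shows "norm u \<le> norm v"
  unfolding norm_vec_def using assms by (intro L2_set_mono) auto

text \<open>A three-point identity: with \<open>a\<close> the new iterate, \<open>b\<close> the old
  one and \<open>c\<close> the target, it turns inner products into telescoping squares.\<close>

lemma inner_diff_diff_eq:
  fixes a b c :: "'a::real_inner"
  shows "(a - c) \<bullet> (a - b) = ((norm (a - c))\<^sup>2 + (norm (a - b))\<^sup>2 - (norm (b - c))\<^sup>2) / 2"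
  by (simp add: power2_norm_eq_inner inner_diff_left inner_diff_right inner_commute)

lemma symmetric_matrix_inner_commute:
  fixes S :: "real ^ 'n ^ 'n"
  assumes "transpose S = S"
  shows "u \<bullet> (S *v v) = v \<bullet> (S *v u)"
  by (metis assms dot_lmul_matrix inner_commute transpose_matrix_vector)

lemma power2_norm_wrt:
  assumes "symmetric_pos_def S"
  shows "(norm_wrt S u)\<^sup>2 = u \<bullet> (S *v u)"
proof -
  have "0 \<le> u \<bullet> (S *v u)"
    using assms by (cases "u = 0") (auto simp: symmetric_pos_def_def intro: less_imp_le)
  then show ?thesis
    by (simp add: norm_wrt_def)
qed

lemma norm_wrt_commute: "norm_wrt S (u - v) = norm_wrt S (v - u)"
proof -
  have "norm_wrt S (- z) = norm_wrt S z" for z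
    using matrix_vector_mult_scaleR[of S "-1" z] by (simp add: norm_wrt_def)
  from this[of "u - v"] show ?thesis
    by simp
qed

lemma norm_wrt_diff_diff_eq:
  assumes "symmetric_pos_def S"
  shows "(a - c) \<bullet> (S *v (a - b)) =
    ((norm_wrt S (a - c))\<^sup>2 + (norm_wrt S (a - b))\<^sup>2 - (norm_wrt S (b - c))\<^sup>2) / 2"
proof -
  have sym: "transpose S = S"
    using assms by (simp add: symmetric_pos_def_def)
  show ?thesis
    unfolding power2_norm_wrt[OF assms]
    using symmetric_matrix_inner_commute[OF sym, of a b]
      symmetric_matrix_inner_commute[OF sym, of a c]
      symmetric_matrix_inner_commute[OF sym, of b c]
    by (simp add: matrix_vector_mult_diff_distrib inner_diff_left inner_diff_right)
qed

text \<open>Eigenvectors of a symmetric matrix for distinct eigenvalues are orthogonal, so choosing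
  one per eigenvalue gives an independent set. Finiteness gives the \<open>Max\<close> in
  \<open>lambda_max\<close> its meaning.\<close>

lemma finite_eigenvalues_symmetric:
  fixes S :: "real ^ 'n ^ 'n"
  assumes "transpose S = S"
  shows "finite {c. \<exists>v. v \<noteq> 0 \<and> S *v v = c *\<^sub>R v}"
proof -
  define E where "E = {c. \<exists>v. v \<noteq> 0 \<and> S *v v = c *\<^sub>R v}"
  have "\<exists>e. \<forall>c\<in>E. e c \<noteq> 0 \<and> S *v e c = c *\<^sub>R e c"
    unfolding E_def by (rule bchoice) blast
  then obtain e where e: "\<And>c. c \<in> E \<Longrightarrow> e c \<noteq> 0 \<and> S *v e c = c *\<^sub>R e c"
    by blast
  have orth: "e c \<bullet> e d = 0" if "c \<in> E" "d \<in> E" "c \<noteq> d" for c d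
    using symmetric_matrix_inner_commute[OF assms, of "e c" "e d"] e[OF that(1)] e[OF that(2)] that(3)
    by (simp add: inner_commute)
  have inj: "inj_on e E"
    using orth e by (metis (mono_tags, lifting) inj_onI inner_eq_zero_iff)
  have "pairwise orthogonal (e ` E)"
    using orth by (auto simp: pairwise_def orthogonal_def)
  moreover have "0 \<notin> e ` E"
    using e by auto
  ultimately have "independent (e ` E)"
    by (rule pairwise_orthogonal_independent)
  then show ?thesis
    unfolding E_def[symmetric] using inj independent_imp_finite finite_imageD by blast
qed

text \<open>First-order optimality at \<open>t = 0\<close> without derivatives; it yields
  stationarity of the Rayleigh quotient below.\<close>

lemma nonneg_quadratic_imp_linear_zero:
  fixes a c :: real
  assumes "\<And>t. 0 \<le> 2 * t * a + t\<^sup>2 * c"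
  shows "a = 0"
proof (rule ccontr)
  assume "a \<noteq> 0"
  \<comment> \<open>\<open>K\<close> is a positive upper bound of \<open>c\<close>, whatever its
    sign, and \<open>t\<close> minimizes \<open>2 * t * a + t\<^sup>2 * K\<close>.\<close>
  define K where "K = \<bar>c\<bar> + 1"
  define t where "t = - a / K"
  have K: "0 < K" "c \<le> K"
    by (auto simp: K_def)
  have "2 * t * a + t\<^sup>2 * c \<le> 2 * t * a + t\<^sup>2 * K"
    using K by (intro add_left_mono mult_left_mono) auto
  also have "\<dots> = - (a\<^sup>2 / K)"
    using K by (simp add: t_def power2_eq_square)
  also have "\<dots> < 0"
    using K \<open>a \<noteq> 0\<close> by simp
  finally show False
    using assms[of t] by simp
qed

text \<open>The Rayleigh quotient attains its maximum on the compact unit sphere. A maximizer is an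
  eigenvector, so the maximum is an eigenvalue and lies below \<open>lambda_max S\<close>.\<close>

lemma quadratic_form_le_lambda_max:
  fixes S :: "real ^ 'n ^ 'n"
  assumes sym: "transpose S = S"
  shows "u \<bullet> (S *v u) \<le> lambda_max S * (norm u)\<^sup>2"
proof -
  have "\<exists>v\<in>sphere 0 1. \<forall>u\<in>sphere 0 1. u \<bullet> (S *v u) \<le> v \<bullet> (S *v v)"
  proof (rule continuous_attains_sup)
    show "sphere (0::real^'n) 1 \<noteq> {}"
      using vector_choose_size[of 1, where ?'a = "real^'n"] by auto
  qed (auto intro!: continuous_intros matrix_vector_mult_linear_continuous_on)
  then obtain v :: "real^'n" where v: "norm v = 1"
    and max: "\<And>u. norm u = 1 \<Longrightarrow> u \<bullet> (S *v u) \<le> v \<bullet> (S *v v)"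
    by auto
  define c where "c = v \<bullet> (S *v v)"
  have le: "u \<bullet> (S *v u) \<le> c * (norm u)\<^sup>2" for u
  proof (cases "u = 0")
    case False
    have "(u /\<^sub>R norm u) \<bullet> (S *v (u /\<^sub>R norm u)) \<le> c"
      unfolding c_def using False by (intro max) simp
    then show ?thesis
      using False by (simp add: matrix_vector_mult_scaleR field_simps power2_eq_square)
  qed simp
  \<comment> \<open>Along \<open>v + t *\<^sub>R h\<close> the bound \<open>le\<close> is a
    nonnegative quadratic in \<open>t\<close> without constant term; its linear coefficient vanishes
    for every \<open>h\<close>, which is the eigenvector equation.\<close>
  have "h \<bullet> (c *\<^sub>R v - S *v v) = 0" for h
  proof (rule nonneg_quadratic_imp_linear_zero)
    fix t :: real
    show "0 \<le> 2 * t * (h \<bullet> (c *\<^sub>R v - S *v v)) + t\<^sup>2 * (c * (norm h)\<^sup>2 - h \<bullet> (S *v h))"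
      using le[of "v + t *\<^sub>R h"] v symmetric_matrix_inner_commute[OF sym, of h v]
      unfolding power2_norm_eq_inner norm_eq_1
      by (simp add: c_def matrix_vector_right_distrib matrix_vector_mult_scaleR inner_add_left
          inner_add_right inner_diff_right inner_commute power2_eq_square algebra_simps)
  qed
  then have "S *v v = c *\<^sub>R v"
    by (metis eq_iff_diff_eq_0 inner_eq_zero_iff)
  moreover have "v \<noteq> 0"
    using v by auto
  ultimately have "c \<le> lambda_max S"
    unfolding lambda_max_def by (intro Max_ge finite_eigenvalues_symmetric[OF sym]) auto
  then show ?thesis
    using le[of u] mult_right_mono[of c "lambda_max S" "(norm u)\<^sup>2"] by simp
qed

lemma lambda_max_nonneg:
  assumes "symmetric_pos_def (S :: real ^ 'n ^ 'n)"
  shows "0 \<le> lambda_max S"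
proof -
  obtain v :: "real^'n" where v: "norm v = 1"
    using vector_choose_size[of 1, where ?'a = "real^'n"] by auto
  have "v \<noteq> 0"
    using v by auto
  then have "0 < v \<bullet> (S *v v)"
    using assms by (simp add: symmetric_pos_def_def)
  also have "\<dots> \<le> lambda_max S"
    using quadratic_form_le_lambda_max[of S v] assms v by (simp add: symmetric_pos_def_def)
  finally show ?thesis by simp
qed

text \<open>The constant is the minimum of the quadratic form on the unit sphere, positive by
  definiteness. It later turns a bound in the \<open>S\<close>-norm into a Euclidean one.\<close>

lemma norm_wrt_bounded_below:
  fixes S :: "real ^ 'n ^ 'n"
  assumes "symmetric_pos_def S"
  obtains c where "0 < c" "\<And>u. c * (norm u)\<^sup>2 \<le> (norm_wrt S u)\<^sup>2"
proof -
  have "\<exists>v\<in>sphere 0 1. \<forall>u\<in>sphere 0 1. v \<bullet> (S *v v) \<le> u \<bullet> (S *v u)"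
  proof (rule continuous_attains_inf)
    show "sphere (0::real^'n) 1 \<noteq> {}"
      using vector_choose_size[of 1, where ?'a = "real^'n"] by auto
  qed (auto intro!: continuous_intros matrix_vector_mult_linear_continuous_on)
  then obtain v :: "real^'n" where v: "norm v = 1"
    and min: "\<And>u. norm u = 1 \<Longrightarrow> v \<bullet> (S *v v) \<le> u \<bullet> (S *v u)"
    by auto
  show thesis
  proof (rule that)
    have "v \<noteq> 0"
      using v by auto
    then show "0 < v \<bullet> (S *v v)"
      using assms by (simp add: symmetric_pos_def_def)
    show "v \<bullet> (S *v v) * (norm u)\<^sup>2 \<le> (norm_wrt S u)\<^sup>2" for u
    proof (cases "u = 0")
      case False
      have "v \<bullet> (S *v v) \<le> (u /\<^sub>R norm u) \<bullet> (S *v (u /\<^sub>R norm u))"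
        using False by (intro min) simp
      then show ?thesis
        unfolding power2_norm_wrt[OF assms] using False
        by (simp add: matrix_vector_mult_scaleR field_simps power2_eq_square)
    qed (simp add: norm_wrt_def)
  qed
qed

section \<open>Convexity\<close>

text \<open>Passing to real values on the effective domain makes Jensen's inequality for
  \<open>convex_on\<close> applicable to \<open>f\<close>.\<close>

lemma ereal_convex_imp_convex_on:
  assumes "proper_fun f" "ereal_convex f"
  shows "convex_on {z. f z \<noteq> \<infinity>} (\<lambda>z. real_of_ereal (f z))"
proof -
  have key: "f ((1 - t) *\<^sub>R u + t *\<^sub>R v) \<noteq> \<infinity> \<and>
      real_of_ereal (f ((1 - t) *\<^sub>R u + t *\<^sub>R v))
        \<le> (1 - t) * real_of_ereal (f u) + t * real_of_ereal (f v)"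
    if t: "0 < t" "t < 1" and fin: "f u \<noteq> \<infinity>" "f v \<noteq> \<infinity>" for t u v
  proof -
    have "f ((1 - t) *\<^sub>R u + t *\<^sub>R v) \<le> ereal (1 - t) * f u + ereal t * f v"
      using assms(2) t by (simp add: ereal_convex_def)
    moreover obtain fu where "f u = ereal fu"
      using assms(1) fin(1) by (cases "f u") (auto simp: proper_fun_def)
    moreover obtain fv where "f v = ereal fv"
      using assms(1) fin(2) by (cases "f v") (auto simp: proper_fun_def)
    moreover have "f ((1 - t) *\<^sub>R u + t *\<^sub>R v) \<noteq> -\<infinity>"
      using assms(1) by (simp add: proper_fun_def)
    ultimately show ?thesis
      by (cases "f ((1 - t) *\<^sub>R u + t *\<^sub>R v)") auto
  qed
  show ?thesis
  proof (rule convex_onI)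
    show "convex {z. f z \<noteq> \<infinity>}"
      unfolding convex_alt
    proof (intro ballI allI impI)
      fix u v t assume *: "u \<in> {z. f z \<noteq> \<infinity>}" "v \<in> {z. f z \<noteq> \<infinity>}" "0 \<le> t \<and> t \<le> (1::real)"
      \<comment> \<open>The endpoints are separate cases, as \<open>ereal_convex\<close> speaks only
        of \<open>t\<close> strictly between 0 and 1.\<close>
      show "(1 - t) *\<^sub>R u + t *\<^sub>R v \<in> {z. f z \<noteq> \<infinity>}"
        using key[of t u v] * by (cases "t = 0"; cases "t = 1") auto
    qed
  qed (use key in auto)
qed

text \<open>A quadratic upper model of the squared positive part: \<open>2 * max 0 p\<close> is its
  derivative at \<open>p\<close>. Monotonicity allows \<open>q\<close> to lie below
  \<open>p + d\<close>, as convexity of \<open>g\<close> will provide.\<close>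

lemma square_pos_part_le:
  fixes p q d :: real
  assumes "q \<le> p + d"
  shows "(max 0 q)\<^sup>2 \<le> (max 0 p)\<^sup>2 + 2 * max 0 p * d + d\<^sup>2"
proof -
  have "max 0 q \<le> \<bar>max 0 p + d\<bar>"
    using assms by (auto simp: max_def)
  then have "(max 0 q)\<^sup>2 \<le> (max 0 p + d)\<^sup>2"
    by (metis abs_le_square_iff abs_of_nonneg max.cobounded1)
  then show ?thesis
    by (simp add: power2_eq_square algebra_simps)
qed

lemma square_norm_vec_max_le:
  fixes p q d :: "real ^ 'n"
  assumes "q \<le> p + d"
  shows "(norm (vec_max 0 q))\<^sup>2 \<le> (norm (vec_max 0 p))\<^sup>2 + 2 * (vec_max 0 p \<bullet> d) + (norm d)\<^sup>2"
proof -
  have "(\<Sum>i\<in>UNIV. (max 0 (q $ i))\<^sup>2)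
      \<le> (\<Sum>i\<in>UNIV. (max 0 (p $ i))\<^sup>2 + 2 * max 0 (p $ i) * d $ i + (d $ i)\<^sup>2)"
    using assms by (intro sum_mono square_pos_part_le) (auto simp: less_eq_vec_def)
  then show ?thesis
    unfolding power2_norm_eq_inner inner_vec_def
    by (simp add: power2_eq_square sum.distrib sum_distrib_left mult.assoc)
qed

text \<open>Convexity of \<open>g\<close> bounds the smooth part of the augmented Lagrangian on the segment from
  \<open>x\<close> to \<open>z\<close> by its linearization in the values of \<open>A\<close> and \<open>g\<close> plus a quadratic remainder,
  which takes the place of the gradient of \<open>g\<close> and of a subdifferential sum rule.\<close>

lemma aug_lagrangian_subgradient:
  fixes g :: "real ^ 'n \<Rightarrow> real ^ 'm2" and A :: "real ^ 'n ^ 'm1"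
  assumes f: "proper_fun f" "ereal_convex f"
    and g: "\<And>i. convex_on UNIV (\<lambda>z. g z $ i)"
    and \<sigma>: "0 < \<sigma>"
    and v: "v \<in> convex_subdifferential (\<lambda>z. aug_lagrangian f A b g \<sigma> z lam mu) x"
  shows "v \<in> convex_subdifferential
    (\<lambda>z. lagrangian f A b g z (lam + \<sigma> *\<^sub>R (A *v x - b), vec_max 0 (mu + \<sigma> *\<^sub>R g x))) x"
proof -
  define \<phi> where "\<phi> z = lam \<bullet> (A *v z - b) + \<sigma> / 2 * (norm (A *v z - b))\<^sup>2
       + 1 / (2 * \<sigma>) * (norm (vec_max 0 (mu + \<sigma> *\<^sub>R g z)))\<^sup>2
       - 1 / (2 * \<sigma>) * (norm mu)\<^sup>2" for z
  define lam' where "lam' = lam + \<sigma> *\<^sub>R (A *v x - b)"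
  define mu' where "mu' = vec_max 0 (mu + \<sigma> *\<^sub>R g x)"
  have sub: "f x + ereal (\<phi> x) + ereal (v \<bullet> (z - x)) \<le> f z + ereal (\<phi> z)" for z
    using v by (simp add: convex_subdifferential_def aug_lagrangian_def \<phi>_def)
  have nminf: "f z \<noteq> -\<infinity>" for z
    using f(1) by (simp add: proper_fun_def)
  obtain z0 where "f z0 \<noteq> \<infinity>"
    using f(1) by (auto simp: proper_fun_def)
  \<comment> \<open>Otherwise the subgradient inequality at \<open>z0\<close> would put infinity
    below a finite value.\<close>
  then have "f x \<noteq> \<infinity>"
    using sub[of z0] nminf[of z0] by (cases "f z0") auto
  then obtain fx where fx: "f x = ereal fx"
    using nminf[of x] by (cases "f x") auto
  have main: "fx + (lam' \<bullet> (A *v x - b) + mu' \<bullet> g x) + v \<bullet> (z - x)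
      \<le> fz + (lam' \<bullet> (A *v z - b) + mu' \<bullet> g z)" if fz: "f z = ereal fz" for z fz
  proof -
    \<comment> \<open>\<open>D\<close> is the change of the coupling terms from \<open>x\<close> to
      \<open>z\<close> under the updated multipliers; \<open>C\<close> collects the coefficients of
      \<open>t\<^sup>2\<close>.\<close>
    define D where "D = lam' \<bullet> (A *v (z - x)) + mu' \<bullet> (g z - g x)"
    define C where "C = \<sigma> / 2 * (norm (A *v (z - x)))\<^sup>2 + \<sigma> / 2 * (norm (g z - g x))\<^sup>2"
    define d where "d = g z - g x"
    have "0 \<le> fz - fx + D - v \<bullet> (z - x) + t * C" if t: "0 < t" "t < 1" for t
    proof -
      define u where "u = (1 - t) *\<^sub>R x + t *\<^sub>R z"
      have ux: "u - x = t *\<^sub>R (z - x)"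
        by (simp add: u_def algebra_simps)
      have "A *v u - b = (A *v x - b) + A *v (u - x)"
        by (simp add: matrix_vector_mult_diff_distrib)
      then have Au: "A *v u - b = (A *v x - b) + t *\<^sub>R (A *v (z - x))"
        by (simp add: ux matrix_vector_mult_scaleR)
      have "g u \<le> g x + t *\<^sub>R d"
        unfolding less_eq_vec_def
      proof
        fix i show "g u $ i \<le> (g x + t *\<^sub>R d) $ i"
          using convex_onD[OF g[of i], of t x z] t by (simp add: u_def d_def algebra_simps)
      qed
      then have "mu + \<sigma> *\<^sub>R g u \<le> (mu + \<sigma> *\<^sub>R g x) + (\<sigma> * t) *\<^sub>R d"
        using \<sigma> by (simp add: less_eq_vec_def distrib_left[symmetric] mult.assoc)
      from square_norm_vec_max_le[OF this]
      have "1 / (2 * \<sigma>) * (norm (vec_max 0 (mu + \<sigma> *\<^sub>R g u)))\<^sup>2 \<le> 1 / (2 * \<sigma>) *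
          ((norm mu')\<^sup>2 + 2 * (mu' \<bullet> (\<sigma> * t) *\<^sub>R d) + (norm ((\<sigma> * t) *\<^sub>R d))\<^sup>2)"
        unfolding mu'_def using \<sigma> by (intro mult_left_mono) auto
      also have "\<dots> = 1 / (2 * \<sigma>) * (norm mu')\<^sup>2 + t * (mu' \<bullet> d)
          + t\<^sup>2 * (\<sigma> / 2 * (norm d)\<^sup>2)"
        using \<sigma> by (simp add: power_mult_distrib field_simps power2_eq_square)
      finally have gu: "1 / (2 * \<sigma>) * (norm (vec_max 0 (mu + \<sigma> *\<^sub>R g u)))\<^sup>2 \<le> \<dots>" .
      have "lam \<bullet> (p + t *\<^sub>R q) + \<sigma> / 2 * (norm (p + t *\<^sub>R q))\<^sup>2 = lam \<bullet> p + \<sigma> / 2 * (norm p)\<^sup>2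
          + t * ((lam + \<sigma> *\<^sub>R p) \<bullet> q) + t\<^sup>2 * (\<sigma> / 2 * (norm q)\<^sup>2)" for p q
        unfolding power2_norm_eq_inner
        by (simp add: inner_add_left inner_add_right inner_commute[of q p] power2_eq_square field_simps)
      from this[of "A *v x - b" "A *v (z - x)"] gu
      have \<phi>u: "\<phi> u \<le> \<phi> x + t * D + t\<^sup>2 * C"
        unfolding \<phi>_def Au D_def C_def mu'_def[symmetric] lam'_def[symmetric] d_def[symmetric]
          distrib_left
        by linarith
      have "f u \<le> ereal (1 - t) * f x + ereal t * f z"
        using f(2) t by (simp add: ereal_convex_def u_def)
      with fx fz nminf[of u] obtain fu where fu: "f u = ereal fu" "fu \<le> (1 - t) * fx + t * fz"
        by (cases "f u") auto
      have "fx + \<phi> x + t * (v \<bullet> (z - x)) \<le> fu + \<phi> u"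
        using sub[of u] fx fu by (simp add: ux)
      with fu(2) \<phi>u have "0 \<le> t * (fz - fx + D - v \<bullet> (z - x) + t * C)"
        by (simp add: power2_eq_square algebra_simps)
      then show ?thesis
        using t by (simp add: zero_le_mult_iff)
    qed
    \<comment> \<open>After division by \<open>t\<close>, the remainder carries one factor
      \<open>t\<close> and disappears as \<open>t\<close> tends to 0 from the right.\<close>
    then have "\<forall>\<^sub>F t in at_right 0. 0 \<le> fz - fx + D - v \<bullet> (z - x) + t * C"
      by (auto simp: eventually_at_right_field intro!: exI[of _ 1])
    moreover have "((\<lambda>t. fz - fx + D - v \<bullet> (z - x) + t * C)
        \<longlongrightarrow> fz - fx + D - v \<bullet> (z - x) + 0 * C) (at_right 0)"
      by (intro tendsto_intros)
    ultimately have "0 \<le> fz - fx + D - v \<bullet> (z - x) + 0 * C"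
      by (intro tendsto_lowerbound) auto
    then show ?thesis
      by (simp add: D_def matrix_vector_mult_diff_distrib inner_diff_right)
  qed
  show ?thesis
    unfolding convex_subdifferential_def mem_Collect_eq
  proof
    fix z
    have "f x + ereal (lam' \<bullet> (A *v x - b) + mu' \<bullet> g x) + ereal (v \<bullet> (z - x))
        \<le> f z + ereal (lam' \<bullet> (A *v z - b) + mu' \<bullet> g z)"
      using main[of z] nminf[of z] fx by (cases "f z") auto
    then show "lagrangian f A b g x (lam + \<sigma> *\<^sub>R (A *v x - b), vec_max 0 (mu + \<sigma> *\<^sub>R g x))
        + ereal (v \<bullet> (z - x))
      \<le> lagrangian f A b g z (lam + \<sigma> *\<^sub>R (A *v x - b), vec_max 0 (mu + \<sigma> *\<^sub>R g x))"
      by (simp add: lagrangian_def lam'_def mu'_def vec_max_0_nonneg)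
  qed
qed

lemma ergodic_iterate_eq_sum:
  "ergodic_iterate \<sigma> x k = (\<Sum>i<k. (\<sigma> i / (\<Sum>i<k. \<sigma> i)) *\<^sub>R x (Suc i))"
  by (simp add: ergodic_iterate_def scaleR_sum_right divide_inverse mult.commute)

text \<open>Jensen's inequality with weights \<open>\<sigma> i\<close> divided by their sum. The set
  \<open>C\<close> accommodates the effective domain of \<open>f\<close>.\<close>

lemma ergodic_iterate_convex:
  assumes "convex_on C h" "\<And>i. 0 < \<sigma> i" "\<And>i. x (Suc i) \<in> C" "1 \<le> k"
  shows "ergodic_iterate \<sigma> x k \<in> C"
    and "h (ergodic_iterate \<sigma> x k) \<le> (\<Sum>i<k. \<sigma> i * h (x (Suc i))) / (\<Sum>i<k. \<sigma> i)"
proof -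
  have pos: "0 < (\<Sum>i<k. \<sigma> i)"
    using assms(2,4) by (intro sum_pos) (auto simp: lessThan_empty_iff)
  have one: "(\<Sum>i<k. \<sigma> i / (\<Sum>i<k. \<sigma> i)) = 1"
    using pos by (simp flip: sum_divide_distrib)
  have nonneg: "0 \<le> \<sigma> i / (\<Sum>i<k. \<sigma> i)" for i
    using pos assms(2)[of i] by simp
  have ne: "{..<k} \<noteq> {}"
    using assms(4) by (simp add: lessThan_empty_iff)
  show "ergodic_iterate \<sigma> x k \<in> C"
    unfolding ergodic_iterate_eq_sum using assms(1,3) one nonneg
    by (intro convex_sum) (auto simp: convex_on_def)
  have "h (ergodic_iterate \<sigma> x k) \<le> (\<Sum>i<k. \<sigma> i / (\<Sum>i<k. \<sigma> i) * h (x (Suc i)))"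
    unfolding ergodic_iterate_eq_sum
    using assms(3) nonneg by (intro convex_on_sum[OF _ ne assms(1) one]) auto
  then show "h (ergodic_iterate \<sigma> x k) \<le> (\<Sum>i<k. \<sigma> i * h (x (Suc i))) / (\<Sum>i<k. \<sigma> i)"
    by (simp add: sum_divide_distrib)
qed

section \<open>Runs of the algorithm\<close>

locale rip2ALM_run =
  fixes f :: "real ^ 'n \<Rightarrow> ereal"
    and A :: "real ^ 'n ^ 'm1" and b :: "real ^ 'm1"
    and g :: "real ^ 'n \<Rightarrow> real ^ 'm2"
    and S :: "real ^ 'n ^ 'n"
    and \<rho> \<tau>min :: real and \<sigma> \<tau> \<nu> :: "nat \<Rightarrow> real"
    and x \<Delta> w :: "nat \<Rightarrow> real ^ 'n"
    and lam :: "nat \<Rightarrow> real ^ 'm1" and mu :: "nat \<Rightarrow> real ^ 'm2"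
    and xs :: "real ^ 'n" and ys :: "(real ^ 'm1) \<times> (real ^ 'm2)"
  assumes f: "proper_fun f" "ereal_convex f"
    and g: "\<And>i. convex_on UNIV (\<lambda>z. g z $ i)"
    and \<rho>: "0 \<le> \<rho>" "\<rho> < 1"
    and S: "symmetric_pos_def S"
    and \<sigma>: "\<And>k. 0 < \<sigma> k"
    and \<tau>: "0 < \<tau>min" "\<And>k. \<tau>min \<le> \<tau> k" "\<And>k. \<tau> (Suc k) \<le> (1 + \<nu> k) * \<tau> k"
    and \<nu>: "\<And>k. 0 \<le> \<nu> k" "summable \<nu>"
    and saddle: "saddle_point (lagrangian f A b g) xs ys"
    and alg: "rip2ALM f A b g \<rho> \<sigma> \<tau> S x \<Delta> w lam mu"
begin

text \<open>\<open>real_of_ereal\<close> sends infinite values to 0, so \<open>F\<close> represents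
  \<open>f\<close> only where \<open>f\<close> is finite; \<open>f_eq_F\<close> makes the
  passage.\<close>

definition F :: "real ^ 'n \<Rightarrow> real" where
  "F z = real_of_ereal (f z)"

text \<open>Pairing the constraint values makes the coupling term of the Lagrangian a single inner
  product \<open>yh \<bullet> G z\<close>.\<close>

definition G :: "real ^ 'n \<Rightarrow> (real ^ 'm1) \<times> (real ^ 'm2)" where
  "G z = (A *v z - b, g z)"

definition y :: "nat \<Rightarrow> (real ^ 'm1) \<times> (real ^ 'm2)" where
  "y k = (lam k, mu k)"

abbreviation T :: "nat \<Rightarrow> real" where
  "T k \<equiv> Cxy_term S \<tau> x y k"

text \<open>The multiplier \<open>yh\<close> is a parameter so that the same descent estimate serves
  both \<open>ys\<close> and 0; the primal center stays at \<open>xs\<close>.\<close>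

definition potential :: "(real ^ 'm1) \<times> (real ^ 'm2) \<Rightarrow> nat \<Rightarrow> real" where
  "potential yh k = (norm (y k - yh))\<^sup>2 + \<tau> k * (norm_wrt S (x k - xs))\<^sup>2 + (norm (w k - xs))\<^sup>2"

lemma f_not_minf: "f z \<noteq> -\<infinity>"
  using f(1) by (simp add: proper_fun_def)

lemma f_eq_F: "f z \<noteq> \<infinity> \<Longrightarrow> f z = ereal (F z)"
  using f_not_minf[of z] by (cases "f z") (auto simp: F_def)

lemma lagrangian_eq: "0 \<le> snd yh \<Longrightarrow> lagrangian f A b g z yh = f z + ereal (yh \<bullet> G z)"
  by (cases yh) (simp add: lagrangian_def G_def)

lemma \<tau>_pos: "0 < \<tau> k"
  using \<tau>(1) \<tau>(2)[of k] by linarith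

lemma T_nonneg: "0 \<le> T k"
  using \<tau>_pos[of k] by (simp add: Cxy_term_def)

lemma potential_nonneg: "0 \<le> potential yh k"
  using \<tau>_pos[of k] by (simp add: potential_def)

section \<open>Optimality conditions at the saddle point\<close>

lemma saddle_ineqs:
  "lagrangian f A b g xs ys \<le> lagrangian f A b g z ys"
  "lagrangian f A b g xs yh \<le> lagrangian f A b g xs ys"
  using saddle by (simp_all add: saddle_point_def saddle_subdifferential_inv_def
      saddle_subdifferential_def del: split_paired_All flip: zero_ereal_def)

text \<open>Otherwise the saddle value would be minus infinity, whereas the multiplier 0 already
  gives \<open>f xs\<close>.\<close>

lemma ys_nonneg: "0 \<le> snd ys"
proof (rule ccontr)
  assume "\<not> 0 \<le> snd ys"
  then have "lagrangian f A b g xs 0 \<le> -\<infinity>"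
    using saddle_ineqs(2)[of 0] by (simp add: lagrangian_def)
  then show False
    using f_not_minf[of xs] by (simp add: lagrangian_eq)
qed

lemma f_xs: "f xs = ereal (F xs)"
proof (rule f_eq_F)
  obtain z where "f z \<noteq> \<infinity>"
    using f(1) by (auto simp: proper_fun_def)
  then show "f xs \<noteq> \<infinity>"
    using saddle_ineqs(1)[of z] f_eq_F[of z] by (auto simp: lagrangian_eq ys_nonneg)
qed

lemma saddle_dual: "0 \<le> snd yh \<Longrightarrow> yh \<bullet> G xs \<le> ys \<bullet> G xs"
  using saddle_ineqs(2)[of yh] by (simp add: lagrangian_eq ys_nonneg f_xs)

lemma xs_eq_constraint: "A *v xs = b"
proof -
  \<comment> \<open>Shifting the equality multiplier by the residual raises the pairing by the
    squared norm of that residual.\<close>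
  have "(fst ys + (A *v xs - b), snd ys) \<bullet> G xs \<le> ys \<bullet> G xs"
    using ys_nonneg by (intro saddle_dual) simp
  then have "(A *v xs - b) \<bullet> (A *v xs - b) \<le> 0"
    by (cases ys) (simp add: G_def inner_add_left)
  then show ?thesis
    by (metis eq_iff_diff_eq_0 inner_ge_zero inner_eq_zero_iff order_antisym)
qed

lemma xs_ineq_constraint: "g xs \<le> 0"
  unfolding less_eq_vec_def
proof
  fix i
  \<comment> \<open>Raising the \<open>i\<close>-th inequality multiplier by one changes the pairing
    by exactly \<open>g xs $ i\<close>.\<close>
  have "(fst ys, snd ys + axis i 1) \<bullet> G xs \<le> ys \<bullet> G xs"
    using ys_nonneg by (intro saddle_dual) (auto simp: less_eq_vec_def axis_def)
  then show "g xs $ i \<le> 0 $ i"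
    by (cases ys) (simp add: G_def inner_add_left inner_axis')
qed

lemma xs_complementarity: "ys \<bullet> G xs = 0"
proof (rule antisym)
  show "ys \<bullet> G xs \<le> 0"
    using inner_vec_mono[OF ys_nonneg xs_ineq_constraint]
    by (cases ys) (simp add: G_def xs_eq_constraint)
  show "0 \<le> ys \<bullet> G xs"
    using saddle_dual[of 0] by simp
qed

lemma saddle_lower_bound:
  assumes "f z \<noteq> \<infinity>"
  shows "F xs \<le> F z + ys \<bullet> G z"
  using saddle_ineqs(1)[of z] f_eq_F[OF assms]
  by (simp add: lagrangian_eq ys_nonneg f_xs xs_complementarity)

section \<open>One iteration: subgradient, multiplier step and descent\<close>

lemma lam_Suc: "lam (Suc k) = lam k + \<sigma> k *\<^sub>R (A *v x (Suc k) - b)"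
  and mu_Suc: "mu (Suc k) = vec_max 0 (mu k + \<sigma> k *\<^sub>R g (x (Suc k)))"
  and w_Suc: "w (Suc k) = w k - \<sigma> k *\<^sub>R \<Delta> (Suc k)"
  using alg by (simp_all add: rip2ALM_def)

text \<open>Rests on \<open>max 0 (m + s) - m = - min m (- s)\<close>. The first two terms of the
  error criterion are thus the squared multiplier step, and its right-hand side is
  \<open>\<rho> * T k\<close>.\<close>

lemma power2_norm_y_step:
  "(norm (y (Suc k) - y k))\<^sup>2 = (norm (\<sigma> k *\<^sub>R (A *v x (Suc k) - b)))\<^sup>2
    + (norm (vec_min (mu k) (- (\<sigma> k *\<^sub>R g (x (Suc k))))))\<^sup>2"
proof -
  have "mu (Suc k) - mu k = - vec_min (mu k) (- (\<sigma> k *\<^sub>R g (x (Suc k))))"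
    by (simp add: vec_eq_iff mu_Suc max_def min_def)
  then show ?thesis
    by (simp add: y_def lam_Suc norm_Pair)
qed

lemma inexactness:
  "2 * \<bar>(w k - x (Suc k)) \<bullet> (\<sigma> k *\<^sub>R \<Delta> (Suc k))\<bar> + (norm (\<sigma> k *\<^sub>R \<Delta> (Suc k)))\<^sup>2 \<le> \<rho> * T k"
  using alg unfolding rip2ALM_def Cxy_term_def power2_norm_y_step by blast

lemma snd_y_Suc_nonneg: "0 \<le> snd (y (Suc k))"
  by (simp add: y_def mu_Suc vec_max_0_nonneg)

text \<open>The multiplier updates are precisely the shifted multipliers of
  \<open>aug_lagrangian_subgradient\<close>; the proximal term moves to the other side.\<close>

lemma lagrangian_subgradient:
  "\<Delta> (Suc k) - (\<tau> k / \<sigma> k) *\<^sub>R (S *v (x (Suc k) - x k))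
    \<in> convex_subdifferential (\<lambda>z. lagrangian f A b g z (y (Suc k))) (x (Suc k))"
proof -
  obtain v where "\<Delta> (Suc k) = v + (\<tau> k * inverse (\<sigma> k)) *\<^sub>R (S *v (x (Suc k) - x k))"
    and v: "v \<in> convex_subdifferential (\<lambda>z. aug_lagrangian f A b g (\<sigma> k) z (lam k) (mu k)) (x (Suc k))"
    using alg unfolding rip2ALM_def by blast
  with aug_lagrangian_subgradient[OF f g \<sigma> v] show ?thesis
    by (simp add: y_def lam_Suc mu_Suc divide_inverse)
qed

text \<open>The subgradient inequality is tested at \<open>xs\<close>. Its right-hand side is finite
  there, and the coupling term is nonpositive because \<open>xs\<close> is feasible.\<close>

lemma f_iterate_finite: "f (x (Suc k)) \<noteq> \<infinity>"
  and lagrangian_subgradient_xs: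
    "F (x (Suc k)) + y (Suc k) \<bullet> G (x (Suc k))
      + (\<Delta> (Suc k) - (\<tau> k / \<sigma> k) *\<^sub>R (S *v (x (Suc k) - x k))) \<bullet> (xs - x (Suc k)) \<le> F xs"
proof -
  let ?v = "\<Delta> (Suc k) - (\<tau> k / \<sigma> k) *\<^sub>R (S *v (x (Suc k) - x k))"
  have "lagrangian f A b g (x (Suc k)) (y (Suc k)) + ereal (?v \<bullet> (xs - x (Suc k)))
      \<le> lagrangian f A b g xs (y (Suc k))"
    using lagrangian_subgradient[of k] by (simp add: convex_subdifferential_def)
  then have le: "f (x (Suc k)) + ereal (y (Suc k) \<bullet> G (x (Suc k))) + ereal (?v \<bullet> (xs - x (Suc k)))
      \<le> ereal (F xs + y (Suc k) \<bullet> G xs)"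
    by (simp add: lagrangian_eq snd_y_Suc_nonneg f_xs)
  then show fin: "f (x (Suc k)) \<noteq> \<infinity>"
    by auto
  have "y (Suc k) \<bullet> G xs \<le> 0"
    using inner_vec_mono[OF snd_y_Suc_nonneg[of k] xs_ineq_constraint]
    by (simp add: y_def G_def xs_eq_constraint)
  with le show "F (x (Suc k)) + y (Suc k) \<bullet> G (x (Suc k)) + ?v \<bullet> (xs - x (Suc k)) \<le> F xs"
    by (simp add: f_eq_F[OF fin])
qed

text \<open>The inequality part is the variational inequality of the projection onto the nonnegative
  orthant, tested at \<open>snd yh\<close>; the equality part holds with equality.\<close>

lemma multiplier_step_inner:
  assumes "0 \<le> snd yh"
  shows "(y (Suc k) - yh) \<bullet> (y (Suc k) - y k) \<le> \<sigma> k * ((y (Suc k) - yh) \<bullet> G (x (Suc k)))"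
proof -
  define u where "u = mu k + \<sigma> k *\<^sub>R g (x (Suc k))"
  have "(vec_max 0 u - snd yh) \<bullet> (vec_max 0 u - u) \<le> 0"
    unfolding inner_vec_def using assms
    by (intro sum_nonpos) (auto simp: less_eq_vec_def max_def mult_nonneg_nonpos mult_nonpos_nonneg)
  then have "(mu (Suc k) - snd yh) \<bullet> (mu (Suc k) - mu k)
      \<le> \<sigma> k * ((mu (Suc k) - snd yh) \<bullet> g (x (Suc k)))"
    by (simp add: mu_Suc u_def algebra_simps)
  then show ?thesis
    by (cases yh) (simp add: y_def lam_Suc G_def distrib_left)
qed

lemma potential_descent:
  assumes "0 \<le> snd yh"
  shows "2 * \<sigma> k * (F (x (Suc k)) - F xs + yh \<bullet> G (x (Suc k)))
    \<le> potential yh k - potential yh (Suc k)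
      + (\<tau> (Suc k) - \<tau> k) * (norm_wrt S (x (Suc k) - xs))\<^sup>2 - (1 - \<rho>) * T k"
proof -
  let ?x = "x (Suc k)" and ?y = "y (Suc k)"
  define e where "e = \<sigma> k *\<^sub>R \<Delta> (Suc k)"
  have "\<sigma> k * (F ?x + ?y \<bullet> G ?x
      + (\<Delta> (Suc k) - (\<tau> k / \<sigma> k) *\<^sub>R (S *v (?x - x k))) \<bullet> (xs - ?x)) \<le> \<sigma> k * F xs"
    using lagrangian_subgradient_xs[of k] \<sigma>[of k] by (intro mult_left_mono) auto
  also have "\<sigma> k * (F ?x + ?y \<bullet> G ?x
      + (\<Delta> (Suc k) - (\<tau> k / \<sigma> k) *\<^sub>R (S *v (?x - x k))) \<bullet> (xs - ?x))
    = \<sigma> k * F ?x + \<sigma> k * (?y \<bullet> G ?x) - e \<bullet> (?x - xs) + \<tau> k * ((?x - xs) \<bullet> (S *v (?x - x k)))"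
    using \<sigma>[of k] by (simp add: e_def inner_diff_left inner_diff_right inner_commute field_simps)
  finally have "\<sigma> k * (F ?x - F xs + yh \<bullet> G ?x)
    \<le> e \<bullet> (?x - xs) - \<tau> k * ((?x - xs) \<bullet> (S *v (?x - x k))) - \<sigma> k * ((?y - yh) \<bullet> G ?x)"
    by (simp add: inner_diff_left algebra_simps)
  also have "\<dots> \<le> e \<bullet> (?x - xs) - \<tau> k * ((?x - xs) \<bullet> (S *v (?x - x k))) - (?y - yh) \<bullet> (?y - y k)"
    using multiplier_step_inner[OF assms, of k] by simp
  finally have main: "2 * \<sigma> k * (F ?x - F xs + yh \<bullet> G ?x) \<le> 2 * (e \<bullet> (?x - xs))
      - 2 * (\<tau> k * ((?x - xs) \<bullet> (S *v (?x - x k)))) - 2 * ((?y - yh) \<bullet> (?y - y k))"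
    by simp
  \<comment> \<open>Splitting \<open>?x - xs\<close> at \<open>w k\<close> and completing the square
    in \<open>w k - xs\<close> leaves exactly the left-hand side of the error criterion besides the
    telescoping terms.\<close>
  have "2 * (e \<bullet> (?x - xs)) = 2 * (e \<bullet> (?x - w k)) + (norm e)\<^sup>2
      + (norm (w k - xs))\<^sup>2 - (norm (w k - e - xs))\<^sup>2"
    by (simp add: power2_norm_eq_inner inner_diff_left inner_diff_right inner_commute)
  also have "2 * (e \<bullet> (?x - w k)) = - (2 * ((w k - ?x) \<bullet> e))"
    by (simp add: inner_diff_left inner_diff_right inner_commute)
  also have "\<dots> \<le> 2 * \<bar>(w k - ?x) \<bullet> e\<bar>"
    by linarith
  finally have "2 * (e \<bullet> (?x - xs)) \<le> \<rho> * T k + (norm (w k - xs))\<^sup>2 - (norm (w (Suc k) - xs))\<^sup>2"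
    using inexactness[of k] by (simp add: e_def w_Suc)
  moreover have "2 * (\<tau> k * ((?x - xs) \<bullet> (S *v (?x - x k)))) = \<tau> k * (norm_wrt S (?x - xs))\<^sup>2
      + \<tau> k * (norm_wrt S (?x - x k))\<^sup>2 - \<tau> k * (norm_wrt S (x k - xs))\<^sup>2"
    unfolding norm_wrt_diff_diff_eq[OF S] by (simp add: field_simps)
  moreover have "2 * ((?y - yh) \<bullet> (?y - y k))
      = (norm (?y - yh))\<^sup>2 + (norm (?y - y k))\<^sup>2 - (norm (y k - yh))\<^sup>2"
    unfolding inner_diff_diff_eq by simp
  \<comment> \<open>The identity in \<open>S\<close> carries \<open>\<tau> k\<close>, but the next
    potential carries \<open>\<tau> (Suc k)\<close>: hence the extra growth term. The coefficient
    \<open>1 - \<rho>\<close> is what the error criterion leaves of \<open>T k\<close>.\<close>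
  ultimately show ?thesis
    using main by (simp add: potential_def Cxy_term_def algebra_simps)
qed

text \<open>At \<open>ys\<close> the Lagrangian gap is nonnegative and drops out. The growth term is
  then bounded through the old potential, which produces the factor
  \<open>1 + \<nu> k\<close>.\<close>

lemma potential_saddle_Suc_le:
  "potential ys (Suc k) \<le> (1 + \<nu> k) * potential ys k - (1 - \<rho>) * T k"
proof -
  define q where "q = (norm_wrt S (x (Suc k) - xs))\<^sup>2"
  have rT: "0 \<le> (1 - \<rho>) * T k"
    using \<rho> T_nonneg by simp
  have "0 \<le> 2 * \<sigma> k * (F (x (Suc k)) - F xs + ys \<bullet> G (x (Suc k)))"
    using saddle_lower_bound[OF f_iterate_finite[of k]] \<sigma>[of k] by simp
  with potential_descent[OF ys_nonneg, of k]
  have le: "potential ys (Suc k) \<le> potential ys k + (\<tau> (Suc k) - \<tau> k) * q - (1 - \<rho>) * T k"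
    unfolding q_def by linarith
  \<comment> \<open>Removing the growth term from the new potential still leaves
    \<open>\<tau> k * q\<close>; by \<open>le\<close> this is at most the old potential.\<close>
  have "\<tau> k * q \<le> potential ys (Suc k) - (\<tau> (Suc k) - \<tau> k) * q"
    by (simp add: potential_def q_def algebra_simps)
  with le rT have "\<tau> k * q \<le> potential ys k"
    by linarith
  then have "\<nu> k * (\<tau> k * q) \<le> \<nu> k * potential ys k"
    by (rule mult_left_mono) (rule \<nu>)
  moreover have "(\<tau> (Suc k) - \<tau> k) * q \<le> \<nu> k * (\<tau> k * q)"
    using mult_right_mono[OF \<tau>(3)[of k], of q] by (simp add: q_def algebra_simps)
  ultimately show ?thesis
    using le by (simp add: algebra_simps)
qed

section \<open>Boundedness of the iterates and summability of the steps\<close>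

lemma convergent_prod_\<nu>: "convergent_prod (\<lambda>k. 1 + \<nu> k)"
  using \<nu> by (intro abs_convergent_prod_imp_convergent_prod summable_imp_abs_convergent_prod) simp

lemma prod_le_prodinf_\<nu>: "(\<Prod>i<k. 1 + \<nu> i) \<le> (\<Prod>i. 1 + \<nu> i)"
  using \<nu> convergent_prod_\<nu>
  by (intro prod_le_prodinf[OF convergent_prod_has_prod]) (auto intro: add_nonneg_nonneg)

text \<open>A discrete Gronwall bound, applied both to \<open>\<tau>\<close> and to the potential at
  \<open>ys\<close>.\<close>

lemma le_prodinf_\<nu>I:
  assumes "\<And>k. u (Suc k) \<le> (1 + \<nu> k) * u k" "0 \<le> u 0"
  shows "u k \<le> u 0 * (\<Prod>i. 1 + \<nu> i)"
proof -
  have "u k \<le> u 0 * (\<Prod>i<k. 1 + \<nu> i)"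
  proof (induction k)
    case (Suc k)
    have "u (Suc k) \<le> (1 + \<nu> k) * u k"
      by (rule assms)
    also have "\<dots> \<le> (1 + \<nu> k) * (u 0 * (\<Prod>i<k. 1 + \<nu> i))"
      using Suc \<nu>(1)[of k] by (intro mult_left_mono) auto
    finally show ?case
      by (simp add: mult_ac)
  qed simp
  also have "\<dots> \<le> u 0 * (\<Prod>i. 1 + \<nu> i)"
    using prod_le_prodinf_\<nu> assms(2) by (rule mult_left_mono)
  finally show ?thesis .
qed

lemma \<tau>_le_tau_max: "\<tau> k \<le> tau_max \<tau> \<nu>"
  unfolding tau_max_def using \<tau>(3) less_imp_le[OF \<tau>_pos] by (rule le_prodinf_\<nu>I)

lemma potential_saddle_le: "potential ys k \<le> potential ys 0 * (\<Prod>i. 1 + \<nu> i)"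
proof (rule le_prodinf_\<nu>I[OF _ potential_nonneg])
  show "potential ys (Suc k) \<le> (1 + \<nu> k) * potential ys k" for k
    using potential_saddle_Suc_le[of k] mult_nonneg_nonneg[of "1 - \<rho>" "T k"] \<rho> T_nonneg[of k]
    by linarith
qed

lemma bounded_y: "bounded (range y)"
proof -
  have "dist (y k) ys \<le> sqrt (potential ys 0 * (\<Prod>i. 1 + \<nu> i))" for k
  proof (rule real_le_rsqrt)
    have "(dist (y k) ys)\<^sup>2 \<le> potential ys k"
      using \<tau>_pos[of k] by (simp add: potential_def dist_norm)
    also note potential_saddle_le
    finally show "(dist (y k) ys)\<^sup>2 \<le> potential ys 0 * (\<Prod>i. 1 + \<nu> i)" .
  qed
  then have "range y \<subseteq> cball ys (sqrt (potential ys 0 * (\<Prod>i. 1 + \<nu> i)))"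
    by (auto simp: dist_commute)
  then show ?thesis
    by (rule bounded_subset[OF bounded_cball])
qed

lemma bounded_x: "bounded (range x)"
proof -
  obtain c where c: "0 < c" "\<And>u. c * (norm u)\<^sup>2 \<le> (norm_wrt S u)\<^sup>2"
    using norm_wrt_bounded_below[OF S] by blast
  have "dist (x k) xs \<le> sqrt (potential ys 0 * (\<Prod>i. 1 + \<nu> i) / (\<tau>min * c))" for k
  proof (rule real_le_rsqrt)
    \<comment> \<open>Positive lower bounds on \<open>\<tau>\<close> and on the form of
      \<open>S\<close> convert the weighted term of the potential into a Euclidean distance.\<close>
    have "\<tau>min * (c * (norm (x k - xs))\<^sup>2) \<le> \<tau> k * (norm_wrt S (x k - xs))\<^sup>2"
      using \<tau>(1) \<tau>(2)[of k] c by (intro mult_mono) auto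
    also have "\<dots> \<le> potential ys k"
      by (simp add: potential_def)
    also note potential_saddle_le
    finally show "(dist (x k) xs)\<^sup>2 \<le> potential ys 0 * (\<Prod>i. 1 + \<nu> i) / (\<tau>min * c)"
      using c(1) \<tau>(1) by (simp add: dist_norm field_simps)
  qed
  then have "range x \<subseteq> cball xs (sqrt (potential ys 0 * (\<Prod>i. 1 + \<nu> i) / (\<tau>min * c)))"
    by (auto simp: dist_commute)
  then show ?thesis
    by (rule bounded_subset[OF bounded_cball])
qed

text \<open>Telescoping the one-step inequality at \<open>ys\<close>, with all potentials below one
  constant \<open>P\<close>, leaves a total growth of at most \<open>P\<close> times the sum of
  \<open>\<nu>\<close>. Dividing by \<open>1 - \<rho>\<close> bounds the partial sums.\<close>

lemma summable_T: "summable (Cxy_term S \<tau> x y)"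
proof (rule summableI_nonneg_bounded[OF T_nonneg])
  fix k
  define P where "P = potential ys 0 * (\<Prod>i. 1 + \<nu> i)"
  have P: "potential ys i \<le> P" for i
    unfolding P_def by (rule potential_saddle_le)
  have "(1 - \<rho>) * (\<Sum>i<k. T i) \<le> potential ys 0 - potential ys k + P * (\<Sum>i<k. \<nu> i)"
  proof (induction k)
    case (Suc k)
    have "\<nu> k * potential ys k \<le> P * \<nu> k"
      using mult_right_mono[OF P[of k] \<nu>(1)[of k]] by (simp add: mult.commute)
    with Suc potential_saddle_Suc_le[of k] show ?case
      by (simp add: algebra_simps)
  qed simp
  also have "\<dots> \<le> potential ys 0 + P * (\<Sum>i. \<nu> i)"
  proof -
    have "P * (\<Sum>i<k. \<nu> i) \<le> P * (\<Sum>i. \<nu> i)"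
      using \<nu> order_trans[OF potential_nonneg P] by (intro mult_left_mono sum_le_suminf) auto
    then show ?thesis
      using potential_nonneg[of ys k] by linarith
  qed
  finally show "(\<Sum>i<k. T i) \<le> (potential ys 0 + P * (\<Sum>i. \<nu> i)) / (1 - \<rho>)"
    using \<rho>(2) by (simp add: field_simps)
qed

section \<open>Estimates at the ergodic iterate\<close>

lemma sum_\<sigma>_pos: "1 \<le> k \<Longrightarrow> 0 < (\<Sum>i<k. \<sigma> i)"
  using \<sigma> by (intro sum_pos) (auto simp: lessThan_empty_iff)

lemma ergodic_f_finite: "1 \<le> k \<Longrightarrow> f (ergodic_iterate \<sigma> x k) \<noteq> \<infinity>"
  using ergodic_iterate_convex(1)[OF ereal_convex_imp_convex_on[OF f] \<sigma>, where x = x] f_iterate_finite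
  by simp

lemma ergodic_upper_bound:
  assumes "\<And>k. norm (x k) \<le> Bx" "1 \<le> k"
  shows "F (ergodic_iterate \<sigma> x k) - F xs
    \<le> (const_C0 S \<tau> \<nu> Bx xs (x 0) (y 0) (w 0) + \<rho> * const_Cxy S \<tau> x y) / (\<Sum>i<k. \<sigma> i)"
proof -
  \<comment> \<open>\<open>K\<close> is the factor of the sum of \<open>\<nu>\<close> in
    \<open>const_C0\<close>; its sign later allows partial sums to be replaced by the full
    series.\<close>
  define K where "K = lambda_max S * ((norm xs)\<^sup>2 + Bx\<^sup>2) * tau_max \<tau> \<nu>"
  have K: "0 \<le> K"
    unfolding K_def using lambda_max_nonneg[OF S] order_trans[OF less_imp_le[OF \<tau>_pos] \<tau>_le_tau_max]
    by (intro mult_nonneg_nonneg add_nonneg_nonneg) auto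
  have tau_step: "(\<tau> (Suc i) - \<tau> i) * (norm_wrt S (x (Suc i) - xs))\<^sup>2 \<le> 2 * K * \<nu> i" for i
  proof -
    \<comment> \<open>The parallelogram law without the square of \<open>x (Suc i) + xs\<close>; its
      factor 2 is compensated when the summed estimate is halved.\<close>
    have "(norm (x (Suc i) - xs))\<^sup>2 \<le> 2 * ((norm xs)\<^sup>2 + (norm (x (Suc i)))\<^sup>2)"
      using zero_le_power2[of "norm (x (Suc i) + xs)"]
      by (simp add: power2_norm_eq_inner inner_add_left inner_add_right inner_diff_left
          inner_diff_right inner_commute)
    also have "\<dots> \<le> 2 * ((norm xs)\<^sup>2 + Bx\<^sup>2)"
      using assms(1)[of "Suc i"] by (simp add: power_mono)
    finally have n: "(norm (x (Suc i) - xs))\<^sup>2 \<le> 2 * ((norm xs)\<^sup>2 + Bx\<^sup>2)" .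
    have "(norm_wrt S (x (Suc i) - xs))\<^sup>2 \<le> lambda_max S * (norm (x (Suc i) - xs))\<^sup>2"
      unfolding power2_norm_wrt[OF S] using S
      by (intro quadratic_form_le_lambda_max) (simp add: symmetric_pos_def_def)
    also have "\<dots> \<le> lambda_max S * (2 * ((norm xs)\<^sup>2 + Bx\<^sup>2))"
      using n lambda_max_nonneg[OF S] by (rule mult_left_mono)
    finally have "\<tau> i * (norm_wrt S (x (Suc i) - xs))\<^sup>2
        \<le> tau_max \<tau> \<nu> * (lambda_max S * (2 * ((norm xs)\<^sup>2 + Bx\<^sup>2)))"
      using \<tau>_le_tau_max[of i] \<tau>_pos[of i] by (intro mult_mono) auto
    then have "\<nu> i * (\<tau> i * (norm_wrt S (x (Suc i) - xs))\<^sup>2) \<le> \<nu> i * (2 * K)"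
      using \<nu>(1)[of i] by (intro mult_left_mono) (auto simp: K_def mult_ac)
    moreover have "(\<tau> (Suc i) - \<tau> i) * (norm_wrt S (x (Suc i) - xs))\<^sup>2
        \<le> \<nu> i * (\<tau> i * (norm_wrt S (x (Suc i) - xs))\<^sup>2)"
      using mult_right_mono[OF \<tau>(3)[of i], of "(norm_wrt S (x (Suc i) - xs))\<^sup>2"]
      by (simp add: algebra_simps)
    ultimately show ?thesis
      by (simp add: mult_ac)
  qed
  \<comment> \<open>This is the descent estimate with multiplier 0. In \<open>potential 0 n\<close>
    the first argument is that multiplier, the second the iteration.\<close>
  have "2 * (\<Sum>i<n. \<sigma> i * (F (x (Suc i)) - F xs))
      \<le> potential 0 0 - potential 0 n + 2 * K * (\<Sum>i<n. \<nu> i) + \<rho> * (\<Sum>i<n. T i)" for n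
  proof (induction n)
    case (Suc n)
    have "2 * \<sigma> n * (F (x (Suc n)) - F xs)
        \<le> potential 0 n - potential 0 (Suc n) + 2 * K * \<nu> n - (1 - \<rho>) * T n"
      using potential_descent[of 0 n] tau_step[of n] by simp
    also have "\<dots> \<le> potential 0 n - potential 0 (Suc n) + 2 * K * \<nu> n + \<rho> * T n"
      using T_nonneg[of n] by (simp add: algebra_simps)
    finally show ?case
      using Suc by (simp add: algebra_simps)
  qed simp
  also have "potential 0 0 - potential 0 k + 2 * K * (\<Sum>i<k. \<nu> i) + \<rho> * (\<Sum>i<k. T i)
      \<le> potential 0 0 + 2 * K * (\<Sum>i. \<nu> i) + \<rho> * (\<Sum>i. T i)"
  proof -
    have "2 * K * (\<Sum>i<k. \<nu> i) \<le> 2 * K * (\<Sum>i. \<nu> i)"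
      using \<nu> K by (intro mult_left_mono sum_le_suminf) auto
    moreover have "\<rho> * (\<Sum>i<k. T i) \<le> \<rho> * (\<Sum>i. T i)"
      using \<rho>(1) summable_T T_nonneg by (intro mult_left_mono sum_le_suminf) auto
    ultimately show ?thesis
      using potential_nonneg[of 0 k] by linarith
  qed
  also have "\<dots> = 2 * (const_C0 S \<tau> \<nu> Bx xs (x 0) (y 0) (w 0) + \<rho> * const_Cxy S \<tau> x y)"
    unfolding const_C0_def const_Cxy_def potential_def K_def norm_wrt_commute[of S "x 0" xs]
      norm_minus_commute[of "w 0" xs]
    by (simp add: algebra_simps)
  finally have sum: "(\<Sum>i<k. \<sigma> i * (F (x (Suc i)) - F xs))
      \<le> const_C0 S \<tau> \<nu> Bx xs (x 0) (y 0) (w 0) + \<rho> * const_Cxy S \<tau> x y"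
    by simp
  have "F (ergodic_iterate \<sigma> x k) \<le> (\<Sum>i<k. \<sigma> i * F (x (Suc i))) / (\<Sum>i<k. \<sigma> i)"
    unfolding F_def using f_iterate_finite assms(2)
    by (intro ergodic_iterate_convex(2)[OF ereal_convex_imp_convex_on[OF f] \<sigma>]) auto
  also have "(\<Sum>i<k. \<sigma> i * F (x (Suc i))) / (\<Sum>i<k. \<sigma> i)
      = F xs + (\<Sum>i<k. \<sigma> i * (F (x (Suc i)) - F xs)) / (\<Sum>i<k. \<sigma> i)"
    using sum_\<sigma>_pos[OF assms(2)]
    by (simp add: right_diff_distrib sum_subtractf sum_distrib_right[symmetric] field_simps)
  also have "\<dots> \<le> F xs + (const_C0 S \<tau> \<nu> Bx xs (x 0) (y 0) (w 0) + \<rho> * const_Cxy S \<tau> x y)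
      / (\<Sum>i<k. \<sigma> i)"
    using sum sum_\<sigma>_pos[OF assms(2)] by (intro add_left_mono divide_right_mono) auto
  finally show ?thesis
    by simp
qed

text \<open>The scaled equality residual is exactly the total change of \<open>lam\<close>, and the
  scaled violation of \<open>g\<close> is dominated by that of \<open>mu\<close>. Both ends of the
  telescoped sum have norm at most \<open>By\<close>, whence the factor 2.\<close>

lemma ergodic_feas:
  assumes "\<And>k. norm (y k) \<le> By" "1 \<le> k"
  shows "feas A b g (ergodic_iterate \<sigma> x k) \<le> Xi By \<sigma> k"
proof -
  let ?z = "ergodic_iterate \<sigma> x k" and ?s = "\<Sum>i<k. \<sigma> i"
  have s: "0 < ?s"
    using assms(2) by (rule sum_\<sigma>_pos)
  have "lam k - lam 0 = (\<Sum>i<k. \<sigma> i *\<^sub>R (A *v x (Suc i) - b))"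
    by (induction k) (auto simp: lam_Suc algebra_simps)
  also have "\<dots> = (\<Sum>i<k. \<sigma> i *\<^sub>R (A *v x (Suc i))) - ?s *\<^sub>R b"
    by (simp add: scaleR_diff_right sum_subtractf scaleR_sum_left)
  also have "(\<Sum>i<k. \<sigma> i *\<^sub>R (A *v x (Suc i))) = A *v (\<Sum>i<k. \<sigma> i *\<^sub>R x (Suc i))"
    by (simp add: linear_sum[OF matrix_vector_mul_linear] matrix_vector_mult_scaleR)
  also have "(\<Sum>i<k. \<sigma> i *\<^sub>R x (Suc i)) = ?s *\<^sub>R ?z"
    using s by (simp add: ergodic_iterate_def)
  finally have lam: "lam k - lam 0 = ?s *\<^sub>R (A *v ?z - b)"
    by (simp add: matrix_vector_mult_scaleR scaleR_diff_right)
  have mu: "\<bar>(?s *\<^sub>R vec_max 0 (g ?z)) $ j\<bar> \<le> \<bar>(mu k - mu 0) $ j\<bar>" for j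
  proof -
    \<comment> \<open>The truncation at 0 only increases \<open>mu\<close>, so telescoping gives an
      inequality here; Jensen's inequality carries it to the ergodic iterate.\<close>
    have "(\<Sum>i<n. \<sigma> i * g (x (Suc i)) $ j) \<le> mu n $ j - mu 0 $ j" for n
      by (induction n) (auto simp: mu_Suc)
    moreover have "g ?z $ j \<le> (\<Sum>i<k. \<sigma> i * g (x (Suc i)) $ j) / ?s"
      using assms(2) by (intro ergodic_iterate_convex(2)[OF g \<sigma>]) auto
    ultimately have "?s * g ?z $ j \<le> mu k $ j - mu 0 $ j"
      using s by (smt (verit) pos_le_divide_eq mult.commute)
    then show ?thesis
      using s by (auto simp: max_def)
  qed
  have "?s * feas A b g ?z = norm (?s *\<^sub>R (A *v ?z - b), ?s *\<^sub>R vec_max 0 (g ?z))"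
    using s by (simp add: feas_def flip: scaleR_Pair)
  also have "\<dots> \<le> norm (lam k - lam 0, mu k - mu 0)"
    unfolding norm_Pair lam using norm_le_componentwise_vec[OF mu]
    by (intro real_sqrt_le_mono add_left_mono power_mono) auto
  also have "\<dots> \<le> norm (y k) + norm (y 0)"
    unfolding y_def using norm_triangle_ineq4[of "(lam k, mu k)" "(lam 0, mu 0)"] by simp
  also have "\<dots> \<le> 2 * By"
    using assms(1)[of k] assms(1)[of 0] by simp
  finally show ?thesis
    using s by (simp add: Xi_def field_simps)
qed

text \<open>Since \<open>snd ys\<close> is nonnegative, replacing \<open>g\<close> by its positive
  part only increases the pairing, which Cauchy-Schwarz then bounds by the feasibility
  measure.\<close>

lemma ergodic_lower_bound:
  assumes "\<And>k. norm (y k) \<le> By" "1 \<le> k"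
  shows "- norm ys * Xi By \<sigma> k \<le> F (ergodic_iterate \<sigma> x k) - F xs"
proof -
  let ?z = "ergodic_iterate \<sigma> x k"
  have "ys \<bullet> G ?z \<le> ys \<bullet> (A *v ?z - b, vec_max 0 (g ?z))"
    using inner_vec_mono[OF ys_nonneg, of "g ?z" "vec_max 0 (g ?z)"]
    by (cases ys) (auto simp: G_def less_eq_vec_def)
  also have "\<dots> \<le> norm ys * feas A b g ?z"
    unfolding feas_def by (rule norm_cauchy_schwarz)
  also have "\<dots> \<le> norm ys * Xi By \<sigma> k"
    using ergodic_feas[OF assms] by (intro mult_left_mono) auto
  finally show ?thesis
    using saddle_lower_bound[OF ergodic_f_finite[OF assms(2)]] by simp
qed

end

text \<open>The first four conjuncts express finiteness of the constants: bounds on \<open>x\<close>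
  and \<open>y\<close> exist, and the infinite product and series are genuine limits.\<close>

theorem theorem3p3:
  fixes f :: "real ^ 'n \<Rightarrow> ereal"
    and A :: "real ^ 'n ^ 'm1" and b :: "real ^ 'm1"
    and g :: "real ^ 'n \<Rightarrow> real ^ 'm2"
    and S :: "real ^ 'n ^ 'n"
    and \<rho> \<sigma>min \<tau>min :: real and \<sigma> \<tau> \<nu> :: "nat \<Rightarrow> real"
    and x \<Delta> w :: "nat \<Rightarrow> real ^ 'n"
    and lam :: "nat \<Rightarrow> real ^ 'm1" and mu :: "nat \<Rightarrow> real ^ 'm2"
    and y :: "nat \<Rightarrow> (real ^ 'm1) \<times> (real ^ 'm2)"
    and xs :: "real ^ 'n" and ys :: "(real ^ 'm1) \<times> (real ^ 'm2)"
  assumes f: "proper_fun f" "lower_semicontinuous f" "ereal_convex f"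
    and g: "\<And>i. continuously_differentiable (\<lambda>z. g z $ i)" "\<And>i. convex_on UNIV (\<lambda>z. g z $ i)"
    and \<rho>: "0 \<le> \<rho>" "\<rho> < 1"
    and S: "symmetric_pos_def S"
    and \<sigma>: "0 < \<sigma>min" "\<And>k. \<sigma>min \<le> \<sigma> k"
    and \<tau>: "0 < \<tau>min" "\<And>k. \<tau>min \<le> \<tau> k" "\<And>k. \<tau> (Suc k) \<le> (1 + \<nu> k) * \<tau> k"
    and \<nu>: "\<And>k. 0 \<le> \<nu> k" "summable \<nu>"
    and saddle: "saddle_point (lagrangian f A b g) xs ys"
    and alg: "rip2ALM f A b g \<rho> \<sigma> \<tau> S x \<Delta> w lam mu"
    and y: "\<And>k. y k = (lam k, mu k)"
  shows
    "bounded (range x) \<and> bounded (range y) \<and>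
     convergent_prod (\<lambda>k. 1 + \<nu> k) \<and> summable (Cxy_term S \<tau> x y) \<and>
     (\<forall>B\<^sub>x B\<^sub>y. (\<forall>k. norm (x k) \<le> B\<^sub>x) \<and> (\<forall>k. norm (y k) \<le> B\<^sub>y) \<longrightarrow>
        (\<forall>k\<ge>1.
           feas A b g (ergodic_iterate \<sigma> x k) \<le> Xi B\<^sub>y \<sigma> k \<and>
           ereal (- norm ys * Xi B\<^sub>y \<sigma> k - \<sigma> k / 2 * (Xi B\<^sub>y \<sigma> k)\<^sup>2)
             \<le> f (ergodic_iterate \<sigma> x k) - f xs \<and>
           f (ergodic_iterate \<sigma> x k) - f xs
             \<le> ereal ((const_C0 S \<tau> \<nu> B\<^sub>x xs (x 0) (y 0) (w 0) + \<rho> * const_Cxy S \<tau> x y)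
                        / (\<Sum>i<k. \<sigma> i))))"
proof -
  have \<sigma>_pos: "0 < \<sigma> k" for k
    using \<sigma>(1) \<sigma>(2)[of k] by linarith
  interpret R: rip2ALM_run f A b g S \<rho> \<tau>min \<sigma> \<tau> \<nu> x \<Delta> w lam mu xs ys
    by unfold_locales (use f g \<rho> S \<sigma>_pos \<tau> \<nu> saddle alg in auto)
  have y_eq: "y = R.y"
    by (simp add: fun_eq_iff y R.y_def)
  show ?thesis
    unfolding y_eq
  proof (intro conjI allI impI)
    fix B\<^sub>x B\<^sub>y k
    assume B: "(\<forall>k. norm (x k) \<le> B\<^sub>x) \<and> (\<forall>k. norm (R.y k) \<le> B\<^sub>y)" and k: "1 \<le> (k::nat)"
    let ?z = "ergodic_iterate \<sigma> x k"
    \<comment> \<open>Both values of \<open>f\<close> are finite, so the extended-real difference is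
      an ordinary one.\<close>
    have diff: "f ?z - f xs = ereal (R.F ?z - R.F xs)"
      by (simp add: R.f_eq_F[OF R.ergodic_f_finite[OF k]] R.f_xs)
    show "feas A b g ?z \<le> Xi B\<^sub>y \<sigma> k"
      using B k by (intro R.ergodic_feas) auto
    have "- norm ys * Xi B\<^sub>y \<sigma> k \<le> R.F ?z - R.F xs"
      using B k by (intro R.ergodic_lower_bound) auto
    \<comment> \<open>Subtracting this nonnegative term takes the linear lower bound to the stated
      form.\<close>
    moreover have "0 \<le> \<sigma> k / 2 * (Xi B\<^sub>y \<sigma> k)\<^sup>2"
      using \<sigma>_pos[of k] by simp
    ultimately show "ereal (- norm ys * Xi B\<^sub>y \<sigma> k - \<sigma> k / 2 * (Xi B\<^sub>y \<sigma> k)\<^sup>2) \<le> f ?z - f xs"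
      unfolding diff ereal_less_eq by linarith
    show "f ?z - f xs \<le> ereal ((const_C0 S \<tau> \<nu> B\<^sub>x xs (x 0) (R.y 0) (w 0)
        + \<rho> * const_Cxy S \<tau> x R.y) / (\<Sum>i<k. \<sigma> i))"
      unfolding diff ereal_less_eq using B k by (intro R.ergodic_upper_bound) auto
  qed (use R.bounded_x R.bounded_y R.convergent_prod_\<nu> R.summable_T in auto)
qed

end
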